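(* Let $M\ge 1$ be an integer, $\bar\gamma_{SU}>0$, $\kappa_{SU}>0$, $\rho_{SU}\in[-1,1]$ and $\bar\rho_{SU}=\sqrt{1-\rho_{SU}^2}$. Let $\widehat{\mathbf h}_{SU}\in\mathbb C^M$ be a Rician random vector with factor $\kappa_{SU}$ (line-of-sight scenario) and let $\mathbf z_{SU}\sim\mathcal{CN}(\mathbf 0,\mathbf I_M)$ be independent of $\widehat{\mathbf h}_{SU}$. Define the ground-to-air signal-to-noise ratio $$\gamma_{G2A}=\bar\gamma_{SU}\,\frac{\left|(\rho_{SU}\widehat{\mathbf h}_{SU}+\bar\rho_{SU}\mathbf z_{SU})^{\sf H}\,\widehat{\mathbf h}_{SU}\right|^2}{\|\widehat{\mathbf h}_{SU}\|^{2}} .$$ Then the exact probability density function of $\gamma_{G2A}$ is, for $x>0$, $$f(x)= e^{-M\frac{\kappa_{SU}\rho_{SU}^2}{\kappa_{SU}\bar\rho_{SU}^2+1}-\frac{(\kappa_{SU}+1)x}{\bar\gamma_{SU}(\kappa_{SU}\bar\rho_{SU}^2+1)}}\left(\frac{\kappa_{SU}+1}{\kappa_{SU}\bar\rho_{SU}^2+1}\right)^{M}\frac{1}{\bar\gamma_{SU}^{M}}\sum_{m=0}^{M-1}\binom{M-1}{m}(\bar\gamma_{SU}\bar\rho_{SU}^2)^m(\rho_{SU}^2)^{M-m-1}\left(\frac{x}{\Xi_U}\right)^{\frac{M-m-1}{2}}I_{M-m-1}\!\left(\frac{2\sqrt{\Xi_U x}}{\kappa_{SU}\bar\rho_{SU}^2+1}\right),$$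 where $\Xi_U= M\kappa_{SU}\rho_{SU}^2(\kappa_{SU}+1)\bar\gamma_{SU}^{-1}$.
   Context: $I_\nu$ is the modified Bessel function of the first kind of order $\nu$; $(\cdot)^{\sf H}$ is the conjugate transpose; $\|\cdot\|$ is the Euclidean norm. $\mathcal{CN}(\mathbf 0,\mathbf I_M)$ is the circularly symmetric complex Gaussian law with i.i.d. entries of mean zero and variance $\mathbb E|z|^2=1$. Rician random vector with factor $\kappa$: $\widehat{\mathbf h}=\frac{\sqrt{\kappa}\,\check{\mathbf h}+\mathbf h^{\rm NLOS}}{\sqrt{\kappa+1}}$, where $\check{\mathbf h}$ is a deterministic vector all of whose entries have modulus $1$, and $\mathbf h^{\rm NLOS}\sim\mathcal{CN}(\mathbf 0,\mathbf I)$. Interpretation: $\widehat{\mathbf h}_{SU}$ is the delayed channel estimate from an $M$-antenna base station to a UAV, $\mathbf z_{SU}$ is the innovation due to channel aging, $\rho_{SU}$ is the temporal correlation coefficient, $\bar\gamma_{SU}$ is the average transmit SNR (including path loss), treated as a constant, and the base station uses maximal ratio transmission based on the delayed estimate. Conventions: $0^0=1$; when $\Xi_U=0$ (i.e. $\rho_{SU}=0$) the expression $(x/\Xi_U)^{n/2}I_n(2\sqrt{\Xi_U x}/c)$, with $c>0$, is read as its limit as $\Xi_U\to0^+$. *)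

theory Defs
  imports "HOL-Probability.Probability"
begin

text \<open>Modified Bessel function of the first kind \<open>I\<^sub>n\<close>, for integer order \<open>n \<ge> 0\<close>
  (where \<open>\<Gamma>(k + n + 1) = (k + n)!\<close>) and real argument. Natural-number powers give
  \<open>I\<^sub>0(0) = 1\<close>; \<open>powr\<close> would not, because \<open>0 powr 0 = 0\<close>.\<close>

definition bessel_I :: "nat \<Rightarrow> real \<Rightarrow> real" where
  "bessel_I n x = (\<Sum>k. (x / 2) ^ (2 * k + n) / (fact k * fact (k + n)))"

text \<open>The factor \<open>(x / \<xi>)\<^bsup>n/2\<^esup> I\<^sub>n(2 \<surd>(\<xi> x) / c)\<close>, read at \<open>\<xi> = 0\<close> as its limit for
  \<open>\<xi> \<rightarrow> 0+\<close>.\<close>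

definition bessel_factor :: "nat \<Rightarrow> real \<Rightarrow> real \<Rightarrow> real \<Rightarrow> real" where
  "bessel_factor n c \<xi> x =
     (let F = (\<lambda>t. (x / t) powr (real n / 2) * bessel_I n (2 * sqrt (t * x) / c))
      in if \<xi> = 0 then Lim (at_right 0) F else F \<xi>)"

definition herm_prod :: "complex ^ 'n \<Rightarrow> complex ^ 'n \<Rightarrow> complex" where
  "herm_prod a b = (\<Sum>i\<in>UNIV. cnj (a $ i) * b $ i)"

text \<open>The scalar law \<open>CN(0, 1)\<close>: circular symmetry together with \<open>E |z|\<^sup>2 = 1\<close> means that the
  real and imaginary parts are independent centred Gaussians of variance \<open>1/2\<close> each. Note that
  \<^const>\<open>normal_density\<close> takes the standard deviation.\<close>

definition std_complex_normal :: "'a measure \<Rightarrow> ('a \<Rightarrow> complex) \<Rightarrow> bool" where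
  "std_complex_normal P Z \<longleftrightarrow>
     prob_space.indep_var P borel (\<lambda>\<omega>. Re (Z \<omega>)) borel (\<lambda>\<omega>. Im (Z \<omega>)) \<and>
     distributed P lborel (\<lambda>\<omega>. Re (Z \<omega>)) (normal_density 0 (sqrt (1 / 2))) \<and>
     distributed P lborel (\<lambda>\<omega>. Im (Z \<omega>)) (normal_density 0 (sqrt (1 / 2)))"

definition std_complex_normal_vec :: "'a measure \<Rightarrow> ('a \<Rightarrow> complex ^ 'n) \<Rightarrow> bool" where
  "std_complex_normal_vec P Z \<longleftrightarrow>
     prob_space.indep_vars P (\<lambda>_. borel) (\<lambda>i \<omega>. Z \<omega> $ i) UNIV \<and>
     (\<forall>i. std_complex_normal P (\<lambda>\<omega>. Z \<omega> $ i))"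

definition rician_vec :: "'a measure \<Rightarrow> real \<Rightarrow> ('a \<Rightarrow> complex ^ 'n) \<Rightarrow> bool" where
  "rician_vec P \<kappa> h \<longleftrightarrow>
     (\<exists>h_LOS h_NLOS. (\<forall>i. cmod (h_LOS $ i) = 1) \<and> std_complex_normal_vec P h_NLOS \<and>
        (\<forall>\<omega>\<in>space P. h \<omega> = (sqrt \<kappa> *\<^sub>R h_LOS + h_NLOS \<omega>) /\<^sub>R sqrt (\<kappa> + 1)))"

definition snr_G2A :: "real \<Rightarrow> real \<Rightarrow> complex ^ 'n \<Rightarrow> complex ^ 'n \<Rightarrow> real" where
  "snr_G2A \<gamma> \<rho> h z =
     \<gamma> * (cmod (herm_prod (\<rho> *\<^sub>R h + sqrt (1 - \<rho>\<^sup>2) *\<^sub>R z) h))\<^sup>2 / (norm h)\<^sup>2"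

end

theory Submission
  imports Defs
begin

text \<open>Both the law of the SNR and the claimed density have an explicit Laplace transform, and the
  two agree. Given the channel estimate \<open>h\<close>, a Gaussian integral gives
  \<open>E exp (-s X) = exp (-v |h|\<^sup>2) / (1 + s \<gamma> \<rho>'\<^sup>2)\<close> with \<open>v = s \<gamma> \<rho>\<^sup>2 / (1 + s \<gamma> \<rho>'\<^sup>2)\<close>, and the
  same Gaussian integral, applied to each Rician entry, averages this over \<open>h\<close>. On the density side,
  each Bessel term is a series of Gamma densities, its transform is an exponential times
  \<open>1 / (c\<^sup>n p\<^bsup>n+1\<^esup>)\<close>, and the sum over \<open>m\<close> collapses by the binomial theorem.\<close>

section \<open>Gaussian Laplace transforms of squared moduli\<close>

text \<open>Completing the square: standard deviation \<open>sqrt (1/2)\<close> makes the density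
  \<open>exp (- x\<^sup>2) / sqrt pi\<close>, so the integrand is a constant multiple of the normal
  density with mean \<open>- b / (1 + a)\<close> and variance \<open>1 / (2 * (1 + a))\<close>. That
  constant is the integral.\<close>

lemma nn_integral_normal_exp_quadratic:
  fixes a b :: real
  assumes "a \<ge> 0"
  shows "(\<integral>\<^sup>+x. ennreal (normal_density 0 (sqrt (1/2)) x * exp (- (a * x\<^sup>2 + 2 * b * x))) \<partial>lborel)
    = ennreal (exp (b\<^sup>2 / (1 + a)) / sqrt (1 + a))"
proof -
  define \<sigma> where "\<sigma> = sqrt (1 / (2 * (1 + a)))"
  have s: "\<sigma> > 0" "\<sigma>\<^sup>2 = 1 / (2 * (1 + a))"
    using assms by (auto simp: \<sigma>_def)
  have sq: "- (x\<^sup>2) - (a * x\<^sup>2 + 2 * b * x) = b\<^sup>2 / (1 + a) - (x - - (b / (1 + a)))\<^sup>2 * (1 + a)" for x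
    using assms by (simp add: divide_simps power2_eq_square) algebra
  have eq: "normal_density 0 (sqrt (1/2)) x * exp (- (a * x\<^sup>2 + 2 * b * x))
      = (exp (b\<^sup>2 / (1 + a)) / sqrt (1 + a)) * normal_density (- (b / (1 + a))) \<sigma> x" for x
  proof -
    have "normal_density 0 (sqrt (1/2)) x * exp (- (a * x\<^sup>2 + 2 * b * x))
        = exp (- (x\<^sup>2) - (a * x\<^sup>2 + 2 * b * x)) / sqrt pi"
      by (simp add: normal_density_def exp_add[symmetric])
    also have "\<dots> = exp (b\<^sup>2 / (1 + a)) * exp (- ((x - - (b / (1 + a)))\<^sup>2 * (1 + a))) / sqrt pi"
      unfolding sq by (simp add: exp_diff exp_minus divide_inverse)
    also have "\<dots> = (exp (b\<^sup>2 / (1 + a)) / sqrt (1 + a)) * normal_density (- (b / (1 + a))) \<sigma> x"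
    proof -
      have "2 * pi * \<sigma>\<^sup>2 = pi / (1 + a)" "- y / (2 * \<sigma>\<^sup>2) = - (y * (1 + a))" for y
        using assms unfolding s(2) by (auto simp: field_simps)
      then show ?thesis
        using assms by (simp add: normal_density_def real_sqrt_divide)
    qed
    finally show ?thesis .
  qed
  have "(\<integral>\<^sup>+x. ennreal (normal_density (- (b / (1 + a))) \<sigma> x) \<partial>lborel) = 1"
    using s(1) by (simp add: nn_integral_eq_integral integral_normal_density)
  moreover have "(\<integral>\<^sup>+x. ennreal (c * normal_density (- (b / (1 + a))) \<sigma> x) \<partial>lborel)
      = ennreal c * (\<integral>\<^sup>+x. ennreal (normal_density (- (b / (1 + a))) \<sigma> x) \<partial>lborel)" if "c \<ge> 0" for c
    using that by (simp add: ennreal_mult' nn_integral_cmult)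
  ultimately show ?thesis
    unfolding eq using assms by (simp only: mult_1_right divide_nonneg_nonneg real_sqrt_ge_zero exp_ge_zero add_nonneg_nonneg zero_le_one)
qed

text \<open>Independence turns the joint law into a product measure, so Tonelli applies. Pulled back
  to the sample space, this freezes one variable while the other is averaged, in place of a
  conditional expectation.\<close>

lemma (in prob_space) nn_integral_indep_var:
  assumes "indep_var S X T Y" and [measurable]: "f \<in> borel_measurable (S \<Otimes>\<^sub>M T)"
  shows "(\<integral>\<^sup>+\<omega>. f (X \<omega>, Y \<omega>) \<partial>M) = (\<integral>\<^sup>+\<omega>. (\<integral>\<^sup>+\<omega>'. f (X \<omega>, Y \<omega>') \<partial>M) \<partial>M)"
proof -
  have [measurable]: "X \<in> M \<rightarrow>\<^sub>M S" "Y \<in> M \<rightarrow>\<^sub>M T"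
    and eq: "distr M S X \<Otimes>\<^sub>M distr M T Y = distr M (S \<Otimes>\<^sub>M T) (\<lambda>x. (X x, Y x))"
    using assms(1) by (auto simp: indep_var_distribution_eq)
  interpret Y: prob_space "distr M T Y" by (rule prob_space_distr) simp
  have "(\<integral>\<^sup>+\<omega>. f (X \<omega>, Y \<omega>) \<partial>M) = integral\<^sup>N (distr M S X \<Otimes>\<^sub>M distr M T Y) f"
    unfolding eq by (simp add: nn_integral_distr)
  also have "\<dots> = (\<integral>\<^sup>+x. (\<integral>\<^sup>+y. f (x, y) \<partial>distr M T Y) \<partial>distr M S X)"
    by (rule Y.nn_integral_fst[symmetric]) simp
  also have "\<dots> = (\<integral>\<^sup>+\<omega>. (\<integral>\<^sup>+\<omega>'. f (X \<omega>, Y \<omega>') \<partial>M) \<partial>M)"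
    by (subst nn_integral_distr) (auto intro!: nn_integral_cong nn_integral_distr dest: measurable_space)
  finally show ?thesis .
qed

lemma (in prob_space) std_complex_normal_measurable:
  assumes "std_complex_normal M Z"
  shows "Z \<in> borel_measurable M"
proof -
  have "(\<lambda>\<omega>. Re (Z \<omega>)) \<in> borel_measurable M" "(\<lambda>\<omega>. Im (Z \<omega>)) \<in> borel_measurable M"
    using assms by (auto simp: std_complex_normal_def distributed_def)
  then show ?thesis
    by (simp add: borel_measurable_complex_iff)
qed

text \<open>The expanded squared modulus is a quadratic in \<open>Re (Z \<omega>)\<close> plus one
  in \<open>Im (Z \<omega>)\<close>, with no mixed term. Since the two parts are independent, the
  integral factors into two real Gaussian integrals.\<close>

lemma (in prob_space) std_complex_normal_laplace:
  fixes \<alpha> u :: complex and s :: real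
  assumes Z: "std_complex_normal M Z" and "s \<ge> 0"
  shows "(\<integral>\<^sup>+\<omega>. ennreal (exp (- s * (cmod (\<alpha> + cnj (Z \<omega>) * u))\<^sup>2)) \<partial>M)
    = ennreal (exp (- s * (cmod \<alpha>)\<^sup>2 / (1 + s * (cmod u)\<^sup>2)) / (1 + s * (cmod u)\<^sup>2))"
proof -
  define a where "a = s * (cmod u)\<^sup>2"
  define p where "p = s * Re (cnj \<alpha> * u)"
  define q where "q = s * Im (cnj \<alpha> * u)"
  have a: "a \<ge> 0" using assms by (simp add: a_def)
  define g where "g b x = exp (- (a * x\<^sup>2 + 2 * b * x))" for b x :: real
  have [measurable]: "g b \<in> borel_measurable borel" for b
    unfolding g_def by measurable
  have eq: "exp (- s * (cmod (\<alpha> + cnj z * u))\<^sup>2) = exp (- s * (cmod \<alpha>)\<^sup>2) * g p (Re z) * g q (Im z)" for z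
    by (simp add: g_def exp_add[symmetric] a_def p_def q_def cmod_power2) (simp add: power2_eq_square algebra_simps)
  have ind: "indep_var borel (\<lambda>\<omega>. Re (Z \<omega>)) borel (\<lambda>\<omega>. Im (Z \<omega>))"
    and dR: "distributed M lborel (\<lambda>\<omega>. Re (Z \<omega>)) (normal_density 0 (sqrt (1 / 2)))"
    and dI: "distributed M lborel (\<lambda>\<omega>. Im (Z \<omega>)) (normal_density 0 (sqrt (1 / 2)))"
    using Z by (auto simp: std_complex_normal_def)
  have [measurable]: "Z \<in> borel_measurable M"
    using Z by (rule std_complex_normal_measurable)
  have one: "(\<integral>\<^sup>+\<omega>. ennreal (g b (X \<omega>)) \<partial>M) = ennreal (exp (b\<^sup>2 / (1 + a)) / sqrt (1 + a))"
    if "distributed M lborel X (normal_density 0 (sqrt (1 / 2)))" for b X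
  proof -
    have "(\<integral>\<^sup>+\<omega>. ennreal (g b (X \<omega>)) \<partial>M)
        = (\<integral>\<^sup>+x. ennreal (normal_density 0 (sqrt (1 / 2)) x) * ennreal (g b x) \<partial>lborel)"
      by (rule distributed_nn_integral[OF that, symmetric]) simp
    also have "\<dots> = ennreal (exp (b\<^sup>2 / (1 + a)) / sqrt (1 + a))"
      by (subst nn_integral_normal_exp_quadratic[OF a, of b, symmetric])
         (simp add: g_def ennreal_mult')
    finally show ?thesis .
  qed
  \<comment> \<open>This is \<open>s\<^sup>2\<close> times the identity |cnj \<alpha> * u|^2 =
    |\<alpha>|^2 |u|^2. The linear coefficients enter the result only through this sum.\<close>
  have pq: "p\<^sup>2 + q\<^sup>2 = s * a * (cmod \<alpha>)\<^sup>2"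
    by (simp add: p_def q_def a_def cmod_power2) algebra
  have "(\<integral>\<^sup>+\<omega>. ennreal (exp (- s * (cmod (\<alpha> + cnj (Z \<omega>) * u))\<^sup>2)) \<partial>M)
     = ennreal (exp (- s * (cmod \<alpha>)\<^sup>2)) * (\<integral>\<^sup>+\<omega>. ennreal (g p (Re (Z \<omega>))) * ennreal (g q (Im (Z \<omega>))) \<partial>M)"
    unfolding eq by (subst nn_integral_cmult[symmetric]) (auto simp: ennreal_mult' g_def mult.assoc)
  also have "(\<integral>\<^sup>+\<omega>. ennreal (g p (Re (Z \<omega>))) * ennreal (g q (Im (Z \<omega>))) \<partial>M)
     = (\<integral>\<^sup>+\<omega>. ennreal (g p (Re (Z \<omega>))) \<partial>M) * (\<integral>\<^sup>+\<omega>. ennreal (g q (Im (Z \<omega>))) \<partial>M)"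
    using nn_integral_indep_var[OF ind, of "\<lambda>(x, y). ennreal (g p x) * ennreal (g q y)"]
    by (simp add: nn_integral_cmult nn_integral_multc)
  also have "\<dots> = ennreal (exp ((p\<^sup>2 + q\<^sup>2) / (1 + a)) / (1 + a))"
    unfolding one[OF dR] one[OF dI] using a
    by (simp add: ennreal_mult'[symmetric] exp_add[symmetric] add_divide_distrib)
  also have "ennreal (exp (- s * (cmod \<alpha>)\<^sup>2)) * \<dots> = ennreal (exp (- s * (cmod \<alpha>)\<^sup>2 + (p\<^sup>2 + q\<^sup>2) / (1 + a)) / (1 + a))"
    by (simp only: exp_add ennreal_mult'[symmetric] exp_ge_zero times_divide_eq_right)
  also have "- s * (cmod \<alpha>)\<^sup>2 + (p\<^sup>2 + q\<^sup>2) / (1 + a) = - s * (cmod \<alpha>)\<^sup>2 / (1 + a)"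
    unfolding pq using a by (simp add: divide_simps) algebra
  finally show ?thesis
    by (simp add: a_def)
qed

text \<open>Induction over the coordinates, one scalar Gaussian integral at a time. The parameter
  \<open>s\<close> is kept arbitrary because each integration changes it; the offset of the scalar
  case absorbs the coordinates not yet integrated.\<close>

lemma (in prob_space) std_complex_normal_vec_laplace:
  fixes \<alpha> :: complex and u :: "'n::finite \<Rightarrow> complex" and s :: real
  assumes Z: "std_complex_normal_vec M Z" and s: "s \<ge> 0"
  shows "(\<integral>\<^sup>+\<omega>. ennreal (exp (- s * (cmod (\<alpha> + (\<Sum>i\<in>UNIV. cnj (Z \<omega> $ i) * u i)))\<^sup>2)) \<partial>M)
    = ennreal (exp (- s * (cmod \<alpha>)\<^sup>2 / (1 + s * (\<Sum>i\<in>UNIV. (cmod (u i))\<^sup>2)))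
        / (1 + s * (\<Sum>i\<in>UNIV. (cmod (u i))\<^sup>2)))"
proof -
  have cn: "std_complex_normal M (\<lambda>\<omega>. Z \<omega> $ i)" for i
    using Z by (simp add: std_complex_normal_vec_def)
  have [measurable]: "(\<lambda>\<omega>. Z \<omega> $ i) \<in> borel_measurable M" for i
    using cn by (rule std_complex_normal_measurable)
  have [measurable]: "cnj \<in> borel_measurable borel"
    by (intro borel_measurable_continuous_onI continuous_intros)
  define N where "N i = distr M borel (\<lambda>\<omega>. Z \<omega> $ i)" for i
  have [measurable_cong]: "sets (N i) = sets borel" for i
    by (simp add: N_def)
  interpret N: prob_space "N i" for i
    unfolding N_def by (rule prob_space_distr) simp
  interpret product_sigma_finite N ..
  have PiM: "distr M (\<Pi>\<^sub>M i\<in>UNIV. borel) (\<lambda>\<omega>. \<lambda>i\<in>UNIV. Z \<omega> $ i) = (\<Pi>\<^sub>M i\<in>UNIV. N i)"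
    using Z unfolding N_def std_complex_normal_vec_def
    by (subst indep_vars_iff_distr_eq_PiM[symmetric]) auto
  have one: "(\<integral>\<^sup>+z. ennreal (exp (- s * (cmod (\<alpha> + cnj z * w))\<^sup>2)) \<partial>N i)
    = ennreal (exp (- s * (cmod \<alpha>)\<^sup>2 / (1 + s * (cmod w)\<^sup>2)) / (1 + s * (cmod w)\<^sup>2))"
    if "s \<ge> 0" for s \<alpha> w i
    unfolding N_def using std_complex_normal_laplace[OF cn that, of \<alpha> i w]
    by (simp add: nn_integral_distr)
  \<comment> \<open>Integrating out the coordinate \<open>j\<close> replaces \<open>s\<close> by \<open>s / (1 + s |u\<^sub>j|\<^sup>2)\<close>.\<close>
  have *: "(\<integral>\<^sup>+x. ennreal (exp (- s * (cmod (\<alpha> + (\<Sum>i\<in>J. cnj (x i) * u i)))\<^sup>2)) \<partial>PiM J N)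
    = ennreal (exp (- s * (cmod \<alpha>)\<^sup>2 / (1 + s * (\<Sum>i\<in>J. (cmod (u i))\<^sup>2)))
        / (1 + s * (\<Sum>i\<in>J. (cmod (u i))\<^sup>2)))" if "finite J" "s \<ge> 0" for J s
    using that
  proof (induction J arbitrary: s)
    case empty
    then show ?case by (simp add: nn_integral_empty del: nn_integral_const)
  next
    case (insert j J)
    define S where "S = (\<Sum>i\<in>J. (cmod (u i))\<^sup>2)"
    define d where "d = 1 + s * (cmod (u j))\<^sup>2"
    have S: "S \<ge> 0" by (simp add: S_def sum_nonneg)
    have d: "d > 0" using insert.prems by (simp add: d_def add_pos_nonneg)
    have "(\<integral>\<^sup>+x. ennreal (exp (- s * (cmod (\<alpha> + (\<Sum>i\<in>insert j J. cnj (x i) * u i)))\<^sup>2)) \<partial>PiM (insert j J) N)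
      = (\<integral>\<^sup>+x. (\<integral>\<^sup>+y. ennreal (exp (- s * (cmod (\<alpha> + (\<Sum>i\<in>insert j J. cnj ((x(j := y)) i) * u i)))\<^sup>2)) \<partial>N j) \<partial>PiM J N)"
      by (rule product_nn_integral_insert) (use insert in \<open>auto\<close>)
    also have "\<dots> = (\<integral>\<^sup>+x. (\<integral>\<^sup>+y. ennreal (exp (- s * (cmod ((\<alpha> + (\<Sum>i\<in>J. cnj (x i) * u i)) + cnj y * u j))\<^sup>2)) \<partial>N j) \<partial>PiM J N)"
    proof (intro nn_integral_cong)
      fix x :: "'n \<Rightarrow> complex" and y :: complex
      have "(\<Sum>i\<in>insert j J. cnj ((x(j := y)) i) * u i) = cnj y * u j + (\<Sum>i\<in>J. cnj (x i) * u i)"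
        using insert.hyps by (auto intro!: sum.cong)
      then show "ennreal (exp (- s * (cmod (\<alpha> + (\<Sum>i\<in>insert j J. cnj ((x(j := y)) i) * u i)))\<^sup>2))
        = ennreal (exp (- s * (cmod ((\<alpha> + (\<Sum>i\<in>J. cnj (x i) * u i)) + cnj y * u j))\<^sup>2))"
        by (simp only: ac_simps)
    qed
    \<comment> \<open>The scalar case is applied with the whole partial sum over \<open>J\<close> in
      the offset.\<close>
    also have "\<dots> = (\<integral>\<^sup>+x. ennreal (1 / d) * ennreal (exp (- (s / d) * (cmod (\<alpha> + (\<Sum>i\<in>J. cnj (x i) * u i)))\<^sup>2)) \<partial>PiM J N)"
      unfolding one[OF insert.prems] using d by (simp add: d_def[symmetric] ennreal_mult'[symmetric])
    also have "\<dots> = ennreal (1 / d) * (\<integral>\<^sup>+x. ennreal (exp (- (s / d) * (cmod (\<alpha> + (\<Sum>i\<in>J. cnj (x i) * u i)))\<^sup>2)) \<partial>PiM J N)"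
      by (rule nn_integral_cmult) simp
    also have "\<dots> = ennreal (1 / d) * ennreal (exp (- (s / d) * (cmod \<alpha>)\<^sup>2 / (1 + s / d * S)) / (1 + s / d * S))"
      unfolding S_def using insert.prems d by (subst insert.IH) auto
    also have "\<dots> = ennreal (exp (- (s / d) * (cmod \<alpha>)\<^sup>2 / (1 + s / d * S)) / (d * (1 + s / d * S)))"
      using d S insert.prems by (simp add: ennreal_mult'[symmetric])
    also have "- (s / d) * (cmod \<alpha>)\<^sup>2 / (1 + s / d * S) = - s * (cmod \<alpha>)\<^sup>2 / (d * (1 + s / d * S))"
      by simp
    \<comment> \<open>The denominators telescope, so the contributions of the coordinates simply add
      up.\<close>
    also have "d * (1 + s / d * S) = d + s * S"
      using d by (simp add: field_simps)
    also have "d + s * S = 1 + s * (\<Sum>i\<in>insert j J. (cmod (u i))\<^sup>2)"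
      using insert.hyps by (simp add: S_def d_def algebra_simps)
    finally show ?case .
  qed
  have "(\<integral>\<^sup>+\<omega>. ennreal (exp (- s * (cmod (\<alpha> + (\<Sum>i\<in>UNIV. cnj (Z \<omega> $ i) * u i)))\<^sup>2)) \<partial>M)
    = (\<integral>\<^sup>+x. ennreal (exp (- s * (cmod (\<alpha> + (\<Sum>i\<in>UNIV. cnj (x i) * u i)))\<^sup>2)) \<partial>PiM UNIV N)"
    unfolding PiM[symmetric] by (subst nn_integral_distr) (auto simp del: distr_cong)
  then show ?thesis
    using *[of UNIV s] s by simp
qed

section \<open>Uniqueness of the Laplace transform on the half-line\<close>

text \<open>The exponential series of \<open>iexp (t * y)\<close> is integrated term by term at
  \<open>y = exp (- x)\<close>. Almost surely \<open>y\<close> is at most 1, so the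
  \<open>n\<close>-th term is bounded by \<open>\<bar>t\<bar> ^ n / fact n\<close>, which is
  summable and justifies the exchange.\<close>

lemma char_distr_exp_uminus:
  assumes M: "real_distribution M" and pos: "AE x in M. 0 \<le> x"
  shows "char (distr M borel (\<lambda>x. exp (- x))) t
    = (\<Sum>n. (\<i> * t) ^ n / fact n * of_real (enn2real (\<integral>\<^sup>+x. ennreal (exp (- real n * x)) \<partial>M)))"
proof -
  interpret real_distribution M by fact
  define f where "f n x = (\<i> * t) ^ n / fact n * complex_of_real (exp (- real n * x))" for n x
  have [measurable]: "f n \<in> borel_measurable borel" for n
    unfolding f_def by measurable
  have bd: "AE x in M. norm (f n x) \<le> \<bar>t\<bar> ^ n / fact n" for n
    using pos by eventually_elim
      (auto simp: f_def norm_mult norm_power norm_divide intro!: divide_right_mono mult_left_le)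
  have int: "integrable M (f n)" for n
    by (rule integrable_const_bound[OF bd]) simp
  have sm: "summable (\<lambda>n. \<bar>t\<bar> ^ n / fact n)"
    using summable_exp[of "\<bar>t\<bar>"] by (simp add: divide_inverse mult.commute)
  have "AE x in M. \<forall>n. norm (f n x) \<le> \<bar>t\<bar> ^ n / fact n"
    using bd by (simp add: AE_all_countable)
  then have sm1: "AE x in M. summable (\<lambda>n. norm (f n x))"
    by eventually_elim (rule summable_comparison_test'[OF sm, of 0], auto)
  have le: "(\<integral>x. norm (f n x) \<partial>M) \<le> \<bar>t\<bar> ^ n / fact n" for n
  proof -
    have "(\<integral>x. norm (f n x) \<partial>M) \<le> (\<integral>x. \<bar>t\<bar> ^ n / fact n \<partial>M)"
      by (rule integral_mono_AE) (use bd int in auto)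
    then show ?thesis using prob_space by simp
  qed
  have sm2: "summable (\<lambda>n. \<integral>x. norm (f n x) \<partial>M)"
    by (rule summable_comparison_test'[OF sm, of 0]) (use le in auto)
  have "char (distr M borel (\<lambda>x. exp (- x))) t = (\<integral>x. iexp (t * exp (- x)) \<partial>M)"
    by (simp add: char_def integral_distr)
  also have "\<dots> = (\<integral>x. (\<Sum>n. f n x) \<partial>M)"
  proof (rule Bochner_Integration.integral_cong[OF refl])
    fix x
    have "f n x = (\<i> * of_real (t * exp (- x))) ^ n /\<^sub>R fact n" for n
      by (simp add: f_def power_mult_distrib exp_of_nat_mult[symmetric] scaleR_conv_of_real field_simps flip: of_real_power)
    then show "iexp (t * exp (- x)) = (\<Sum>n. f n x)"
      by (simp add: exp_def)
  qed
  also have "\<dots> = (\<Sum>n. \<integral>x. f n x \<partial>M)"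
    by (rule integral_suminf[OF int sm1 sm2])
  also have "(\<lambda>n. \<integral>x. f n x \<partial>M)
      = (\<lambda>n. (\<i> * t) ^ n / fact n * of_real (enn2real (\<integral>\<^sup>+x. ennreal (exp (- real n * x)) \<partial>M)))"
    unfolding f_def by (simp add: integral_eq_nn_integral)
  finally show ?thesis .
qed

text \<open>Under \<open>y = exp (-x)\<close> the values of the Laplace transform at natural numbers are the moments
  of a law on \<open>[0, 1]\<close>, and these determine its characteristic function.\<close>

lemma laplace_uniqueness:
  assumes M: "real_distribution M" "AE x in M. 0 \<le> x"
    and N: "real_distribution N" "AE x in N. 0 \<le> x"
    and eq: "\<And>n::nat. (\<integral>\<^sup>+x. ennreal (exp (- real n * x)) \<partial>M) = (\<integral>\<^sup>+x. ennreal (exp (- real n * x)) \<partial>N)"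
  shows "M = N"
proof -
  \<comment> \<open>The substitution is undone by \<open>- ln y\<close>, so no information is lost
    in passing to the image laws.\<close>
  have rd: "real_distribution (distr K borel (\<lambda>x. exp (- x)))"
    and inv: "distr (distr K borel (\<lambda>x. exp (- x))) borel (\<lambda>y. - ln y) = K"
    if "real_distribution K" for K
  proof -
    interpret real_distribution K by fact
    show "real_distribution (distr K borel (\<lambda>x. exp (- x)))"
      by (rule real_distribution_distr) simp
    show "distr (distr K borel (\<lambda>x. exp (- x))) borel (\<lambda>y. - ln y) = K"
      by (simp add: distr_distr comp_def distr_id2)
  qed
  have "char (distr M borel (\<lambda>x. exp (- x))) t = char (distr N borel (\<lambda>x. exp (- x))) t" for t
    using char_distr_exp_uminus[OF M, of t] char_distr_exp_uminus[OF N, of t] by (simp only: eq)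
  then have "char (distr M borel (\<lambda>x. exp (- x))) = char (distr N borel (\<lambda>x. exp (- x)))"
    by (simp add: fun_eq_iff)
  then have "distr M borel (\<lambda>x. exp (- x)) = distr N borel (\<lambda>x. exp (- x))"
    by (rule Levy_uniqueness[OF rd[OF M(1)] rd[OF N(1)]])
  then show ?thesis
    using inv[OF M(1)] inv[OF N(1)] by metis
qed

section \<open>Rician vectors\<close>

lemma power2_norm_vec: "(norm (x :: complex ^ 'n))\<^sup>2 = (\<Sum>i\<in>UNIV. (cmod (x $ i))\<^sup>2)"
  by (simp add: norm_vec_def L2_set_def sum_nonneg)

text \<open>The squared norm is a sum over independent entries, so the transform is a product of
  equal scalar transforms, each with multiplier 1 and an offset of squared modulus \<kappa>. The
  phases of the line-of-sight entries drop out.\<close>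

lemma (in prob_space) rician_vec_laplace:
  fixes h :: "'a \<Rightarrow> complex ^ 'n" and u :: real
  assumes h: "rician_vec M \<kappa> h" and \<kappa>: "\<kappa> > 0" and u: "u \<ge> 0"
  shows "(\<integral>\<^sup>+\<omega>. ennreal (exp (- u * (norm (h \<omega>))\<^sup>2)) \<partial>M)
    = ennreal ((exp (- \<kappa> * u / (\<kappa> + 1 + u)) * ((\<kappa> + 1) / (\<kappa> + 1 + u))) ^ CARD('n))"
proof -
  obtain a n where a: "\<And>i. cmod (a $ i) = 1" and n: "std_complex_normal_vec M n"
    and eq: "\<And>\<omega>. \<omega> \<in> space M \<Longrightarrow> h \<omega> = (sqrt \<kappa> *\<^sub>R a + n \<omega>) /\<^sub>R sqrt (\<kappa> + 1)"
    using h unfolding rician_vec_def by blast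
  have ind: "indep_vars (\<lambda>_. borel) (\<lambda>i \<omega>. n \<omega> $ i) UNIV"
    and cn: "\<And>i. std_complex_normal M (\<lambda>\<omega>. n \<omega> $ i)"
    using n by (auto simp: std_complex_normal_vec_def)
  \<comment> \<open>The normalisation of the Rician vector is moved into the transform
    variable.\<close>
  define s where "s = u / (\<kappa> + 1)"
  have s: "s \<ge> 0" using u \<kappa> by (simp add: s_def)
  \<comment> \<open>Conjugating each entry matches the \<open>cnj (Z \<omega>)\<close> of the scalar
    transform and leaves the modulus unchanged.\<close>
  define \<alpha> where "\<alpha> i = cnj (of_real (sqrt \<kappa>) * a $ i)" for i
  have \<alpha>: "(cmod (\<alpha> i))\<^sup>2 = \<kappa>" for i
    using a \<kappa> by (simp add: \<alpha>_def norm_mult power_mult_distrib)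
  define Y where "Y i z = ennreal (exp (- s * (cmod (\<alpha> i + cnj z * 1))\<^sup>2))" for i z
  have [measurable]: "Y i \<in> borel_measurable borel" for i
  proof -
    have [measurable]: "cnj \<in> borel_measurable borel"
      by (intro borel_measurable_continuous_onI continuous_intros)
    show ?thesis unfolding Y_def by measurable
  qed
  have *: "ennreal (exp (- u * (norm (h \<omega>))\<^sup>2)) = (\<Prod>i\<in>UNIV. Y i (n \<omega> $ i))" if "\<omega> \<in> space M" for \<omega>
  proof -
    have "(cmod (h \<omega> $ i))\<^sup>2 = (cmod (\<alpha> i + cnj (n \<omega> $ i)))\<^sup>2 / (\<kappa> + 1)" for i
    proof -
      have "\<alpha> i + cnj (n \<omega> $ i) = cnj (of_real (sqrt \<kappa>) * a $ i + n \<omega> $ i)"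
        by (simp add: \<alpha>_def)
      then have "cmod (\<alpha> i + cnj (n \<omega> $ i)) = cmod (of_real (sqrt \<kappa>) * a $ i + n \<omega> $ i)"
        by (simp only: complex_mod_cnj)
      moreover have "h \<omega> $ i = (of_real (sqrt \<kappa>) * a $ i + n \<omega> $ i) /\<^sub>R sqrt (\<kappa> + 1)"
        using eq[OF that] by (simp add: scaleR_conv_of_real[where 'a=complex])
      ultimately show ?thesis
        using \<kappa> by (simp add: power_mult_distrib power_inverse divide_inverse)
    qed
    then have "- u * (norm (h \<omega>))\<^sup>2 = (\<Sum>i\<in>UNIV. - s * (cmod (\<alpha> i + cnj (n \<omega> $ i) * 1))\<^sup>2)"
      by (simp add: power2_norm_vec s_def sum_distrib_left sum_negf)
    then show ?thesis
      by (simp add: Y_def exp_sum prod_ennreal)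
  qed
  have "(\<integral>\<^sup>+\<omega>. ennreal (exp (- u * (norm (h \<omega>))\<^sup>2)) \<partial>M) = (\<integral>\<^sup>+\<omega>. (\<Prod>i\<in>UNIV. Y i (n \<omega> $ i)) \<partial>M)"
    by (intro nn_integral_cong *)
  also have "\<dots> = (\<Prod>i\<in>UNIV. \<integral>\<^sup>+\<omega>. Y i (n \<omega> $ i) \<partial>M)"
    by (rule indep_vars_nn_integral) (auto intro: indep_vars_compose2[OF ind])
  also have "\<dots> = (\<Prod>i\<in>(UNIV::'n set). ennreal (exp (- s * \<kappa> / (1 + s)) / (1 + s)))"
    unfolding Y_def by (intro prod.cong refl, subst std_complex_normal_laplace[OF cn s]) (simp add: \<alpha>)
  also have "\<dots> = ennreal ((exp (- s * \<kappa> / (1 + s)) / (1 + s)) ^ CARD('n))"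
    using s by (simp add: ennreal_power)
  also have "- s * \<kappa> / (1 + s) = - \<kappa> * u / (\<kappa> + 1 + u)"
  proof -
    have "1 + s = (\<kappa> + 1 + u) / (\<kappa> + 1)"
      using \<kappa> by (simp add: s_def field_simps)
    then show ?thesis
      using u \<kappa> by (simp add: s_def)
  qed
  also have "exp (- \<kappa> * u / (\<kappa> + 1 + u)) / (1 + s) = exp (- \<kappa> * u / (\<kappa> + 1 + u)) * ((\<kappa> + 1) / (\<kappa> + 1 + u))"
    using u \<kappa> by (simp add: s_def field_simps)
  finally show ?thesis .
qed

lemma (in prob_space) rician_vec_nonzero:
  fixes h :: "'a \<Rightarrow> complex ^ 'n"
  assumes h: "rician_vec M \<kappa> h" and \<kappa>: "\<kappa> > 0"
  shows "AE \<omega> in M. h \<omega> \<noteq> 0"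
proof -
  obtain a n where n: "std_complex_normal_vec M n"
    and eq: "\<And>\<omega>. \<omega> \<in> space M \<Longrightarrow> h \<omega> = (sqrt \<kappa> *\<^sub>R a + n \<omega>) /\<^sub>R sqrt (\<kappa> + 1)"
    using h unfolding rician_vec_def by blast
  fix i :: 'n
  have d: "distributed M lborel (\<lambda>\<omega>. Re (n \<omega> $ i)) (normal_density 0 (sqrt (1 / 2)))"
    using n by (simp add: std_complex_normal_vec_def std_complex_normal_def)
  have "AE \<omega> in M. Re (n \<omega> $ i) \<noteq> - sqrt \<kappa> * Re (a $ i)"
    by (subst distributed_AE2[OF d]) (auto intro: AE_mp[OF AE_lborel_singleton])
  then show ?thesis
  proof (rule AE_mp[OF _ AE_I2], intro impI notI)
    fix \<omega> assume "\<omega> \<in> space M" "Re (n \<omega> $ i) \<noteq> - sqrt \<kappa> * Re (a $ i)" "h \<omega> = 0"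
    then have "sqrt \<kappa> *\<^sub>R a + n \<omega> = 0"
      using eq \<kappa> by simp
    then have "Re ((sqrt \<kappa> *\<^sub>R a + n \<omega>) $ i) = 0"
      by simp
    then show False
      using \<open>Re (n \<omega> $ i) \<noteq> _\<close> by simp
  qed
qed

section \<open>Bessel terms and their Laplace transforms\<close>

text \<open>The Bessel-Clifford function: \<open>I\<^sub>n(x) = (x/2)\<^sup>n C\<^sub>n(x\<^sup>2/4)\<close>. In terms of it
  \<^const>\<open>bessel_factor\<close> is continuous in \<open>\<xi>\<close>, so \<open>\<xi> = 0\<close> needs no separate treatment.\<close>

definition bessel_clifford :: "nat \<Rightarrow> real \<Rightarrow> real" where
  "bessel_clifford n y = (\<Sum>k. y ^ k / (fact k * fact (k + n)))"

lemma summable_bessel_clifford: "summable (\<lambda>k. y ^ k / (fact k * fact (k + n)) :: real)"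
proof (rule summable_comparison_test'[OF summable_exp[of "\<bar>y\<bar>"], of 0])
  fix k :: nat
  have "(1::real) \<le> fact (k + n)" by simp
  then have "inverse (fact k * fact (k + n)) \<le> inverse (fact k :: real)"
    by (simp add: divide_simps)
  then have "inverse (fact k * fact (k + n)) * \<bar>y\<bar> ^ k \<le> inverse (fact k :: real) * \<bar>y\<bar> ^ k"
    by (rule mult_right_mono) simp
  then show "norm (y ^ k / (fact k * fact (k + n))) \<le> inverse (fact k) * \<bar>y\<bar> ^ k"
    by (simp add: power_abs abs_mult divide_inverse mult.commute)
qed

lemma isCont_bessel_clifford: "isCont (bessel_clifford n) y"
proof -
  have "bessel_clifford n = (\<lambda>y. \<Sum>k. inverse (fact k * fact (k + n)) * y ^ k)"
    by (simp add: fun_eq_iff bessel_clifford_def divide_inverse mult.commute)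
  moreover have "summable (\<lambda>k. inverse (fact k * fact (k + n)) * y ^ k)" for y :: real
    using summable_bessel_clifford[of y n] by (simp add: divide_inverse mult.commute)
  ultimately show ?thesis
    using isCont_powser_converges_everywhere by metis
qed

lemma bessel_clifford_nonneg: "y \<ge> 0 \<Longrightarrow> bessel_clifford n y \<ge> 0"
  unfolding bessel_clifford_def by (intro suminf_nonneg summable_bessel_clifford) auto

lemma borel_measurable_bessel_clifford [measurable]: "bessel_clifford n \<in> borel_measurable borel"
  by (intro borel_measurable_continuous_onI continuous_at_imp_continuous_on ballI isCont_bessel_clifford)

lemma bessel_I_eq_bessel_clifford: "bessel_I n x = (x / 2) ^ n * bessel_clifford n ((x / 2)\<^sup>2)"
proof -
  have "bessel_I n x = (\<Sum>k. (x / 2) ^ n * (((x / 2)\<^sup>2) ^ k / (fact k * fact (k + n))))"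
    by (simp only: bessel_I_def power_add power_mult times_divide_eq_right mult.commute[of "((x / 2)\<^sup>2) ^ _"])
  then show ?thesis
    by (simp only: bessel_clifford_def suminf_mult[OF summable_bessel_clifford])
qed

text \<open>For positive \<open>t\<close> the prefactor cancels the square root of \<open>t\<close>
  inside the Bessel power: \<open>sqrt (x / t) * (sqrt (t * x) / c) = x / c\<close>. What remains
  depends on \<open>t\<close> only through an everywhere convergent power series, so the one-sided
  limit at 0 is its value there.\<close>

lemma bessel_factor_eq_bessel_clifford:
  assumes c: "c > 0" and \<xi>: "\<xi> \<ge> 0" and x: "x > 0"
  shows "bessel_factor n c \<xi> x = (x / c) ^ n * bessel_clifford n (x * \<xi> / c\<^sup>2)"
proof -
  define F where "F t = (x / t) powr (real n / 2) * bessel_I n (2 * sqrt (t * x) / c)" for t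
  define G where "G t = (x / c) ^ n * bessel_clifford n (x * t / c\<^sup>2)" for t
  have FG: "F t = G t" if "t > 0" for t
  proof -
    have "(x / t) powr (real n / 2) = (sqrt (x / t)) ^ n"
      using that x by (simp add: powr_half_sqrt[symmetric] powr_powr flip: powr_realpow)
    moreover have "sqrt (x / t) * (sqrt (t * x) / c) = x / c"
      using that x by (simp add: real_sqrt_mult real_sqrt_divide field_simps)
    then have "sqrt (x / t) ^ n * (sqrt (t * x) / c) ^ n = (x / c) ^ n"
      by (metis power_mult_distrib)
    moreover have "(sqrt (t * x) / c)\<^sup>2 = x * t / c\<^sup>2"
      using that x by (simp add: power_divide mult.commute)
    ultimately show ?thesis
      by (simp add: F_def G_def bessel_I_eq_bessel_clifford)
  qed
  show ?thesis
  proof (cases "\<xi> = 0")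
    case True
    have "isCont G 0"
      unfolding G_def using c
      by (intro continuous_intros isCont_o2[OF _ isCont_bessel_clifford]) auto
    then have "(G \<longlongrightarrow> G 0) (at_right 0)"
      unfolding isCont_def by (rule filterlim_mono) (simp_all add: at_le)
    moreover have "eventually (\<lambda>t. G t = F t) (at_right 0)"
      using FG by (auto simp: eventually_at_filter)
    ultimately have "(F \<longlongrightarrow> G 0) (at_right 0)"
      by (rule Lim_transform_eventually)
    then have "Lim (at_right 0) F = G 0"
      by (intro tendsto_Lim) auto
    then show ?thesis
      using True by (simp add: bessel_factor_def F_def[abs_def] G_def)
  next
    case False
    then show ?thesis
      using FG[of \<xi>] \<xi> by (simp add: bessel_factor_def F_def G_def)
  qed
qed

text \<open>Term by term, the integrand is a mixture of Erlang densities, each of mass 1. The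
  integral is therefore the sum of the weights, which is an exponential series.\<close>

lemma nn_integral_exp_bessel_clifford:
  assumes p: "p > 0" and c: "c > 0" and \<xi>: "\<xi> \<ge> 0"
  shows "(\<integral>\<^sup>+x. ennreal (exp (- p * x) * ((x / c) ^ n * bessel_clifford n (x * \<xi> / c\<^sup>2))) * indicator {0<..} x \<partial>lborel)
    = ennreal (exp (\<xi> / (c\<^sup>2 * p)) / (c ^ n * p ^ Suc n))"
proof -
  \<comment> \<open>\<open>erlang_density (k + n) p\<close> carries
    \<open>p ^ (k + n + 1) * x ^ (k + n) / fact (k + n)\<close>, so its index is the shape minus
    one. The weight supplies the inverse power of \<open>p\<close>, and the factorial of
    \<open>k + n\<close> is already in the series.\<close>
  define w where "w k = (\<xi> / (c\<^sup>2 * p)) ^ k / fact k / (c ^ n * p ^ Suc n)" for k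
  have w0: "w k \<ge> 0" for k
    using p c \<xi> by (simp add: w_def)
  have w_sums: "w sums (exp (\<xi> / (c\<^sup>2 * p)) / (c ^ n * p ^ Suc n))"
    unfolding w_def using exp_converges[of "\<xi> / (c\<^sup>2 * p)"]
    by (intro sums_divide) (simp add: divide_inverse mult.commute)
  have coeff: "exp (- p * x) * ((x / c) ^ n * ((x * \<xi> / c\<^sup>2) ^ k / (fact k * fact (k + n))))
      = w k * erlang_density (k + n) p x" if "x > 0" for x k
    using that p c unfolding w_def erlang_density_def
    by (simp add: power_add power_divide power_mult_distrib field_simps)
  \<comment> \<open>The origin is excluded because \<open>erlang_density 0 p 0 = p\<close> is
    nonzero while the indicator vanishes there; it is a null set.\<close>
  have pt: "ennreal (exp (- p * x) * ((x / c) ^ n * bessel_clifford n (x * \<xi> / c\<^sup>2))) * indicator {0<..} x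
      = (\<Sum>k. ennreal (w k) * ennreal (erlang_density (k + n) p x))" if "x \<noteq> 0" for x
  proof (cases "x > 0")
    case True
    have s: "(\<lambda>k. w k * erlang_density (k + n) p x) sums
        (exp (- p * x) * ((x / c) ^ n * bessel_clifford n (x * \<xi> / c\<^sup>2)))"
      unfolding coeff[OF True, symmetric] bessel_clifford_def
      by (intro sums_mult summable_sums summable_bessel_clifford)
    have "(\<Sum>k. ennreal (w k) * ennreal (erlang_density (k + n) p x))
        = (\<Sum>k. ennreal (w k * erlang_density (k + n) p x))"
      using w0 by (simp add: ennreal_mult')
    also have "\<dots> = ennreal (exp (- p * x) * ((x / c) ^ n * bessel_clifford n (x * \<xi> / c\<^sup>2)))"
      using s w0 p by (subst suminf_ennreal2) (auto simp: sums_iff)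
    finally show ?thesis
      using True by simp
  next
    case False
    then show ?thesis
      using that by (simp add: erlang_density_def)
  qed
  have e: "(\<integral>\<^sup>+x. ennreal (erlang_density k p x) \<partial>lborel) = 1" for k
    using nn_integral_erlang_ith_moment[OF p, of k 0] by simp
  have "(\<integral>\<^sup>+x. ennreal (exp (- p * x) * ((x / c) ^ n * bessel_clifford n (x * \<xi> / c\<^sup>2))) * indicator {0<..} x \<partial>lborel)
      = (\<integral>\<^sup>+x. (\<Sum>k. ennreal (w k) * ennreal (erlang_density (k + n) p x)) \<partial>lborel)"
    by (rule nn_integral_cong_AE, rule AE_mp[OF AE_lborel_singleton[of 0] AE_I2], rule impI, rule pt)
  also have "\<dots> = (\<Sum>k. ennreal (w k))"
    by (simp add: nn_integral_suminf nn_integral_cmult e)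
  also have "\<dots> = ennreal (exp (\<xi> / (c\<^sup>2 * p)) / (c ^ n * p ^ Suc n))"
    by (simp only: suminf_ennreal2[OF w0 sums_summable[OF w_sums]] sums_unique[OF w_sums, symmetric])
  finally show ?thesis .
qed

section \<open>The Laplace transform of the SNR\<close>

lemma borel_measurable_vec_nth: "(\<lambda>x :: complex ^ 'n. x $ i) \<in> borel_measurable borel"
  by (intro borel_measurable_continuous_onI continuous_intros)

lemma borel_measurable_snr_G2A:
  "(\<lambda>(x, y). snr_G2A \<gamma> \<rho> x y :: real) \<in> borel_measurable (borel \<Otimes>\<^sub>M (borel :: (complex ^ 'n) measure))"
proof -
  have [measurable]: "cnj \<in> borel_measurable borel"
    by (intro borel_measurable_continuous_onI continuous_intros)
  note [measurable] = borel_measurable_vec_nth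
  show ?thesis
    unfolding snr_G2A_def herm_prod_def split_beta' vector_add_component vector_scaleR_component
    by measurable
qed

lemma snr_G2A_nonneg: "\<gamma> \<ge> 0 \<Longrightarrow> snr_G2A \<gamma> \<rho> x y \<ge> 0"
  by (simp add: snr_G2A_def)

text \<open>This exhibits the product as a deterministic offset plus a form linear in the conjugated
  innovation, the shape required by \<open>std_complex_normal_vec_laplace\<close>.\<close>

lemma herm_prod_aged:
  "herm_prod (\<rho> *\<^sub>R x + r *\<^sub>R y) x
    = of_real (\<rho> * (norm x)\<^sup>2) + (\<Sum>i\<in>UNIV. cnj (y $ i) * (of_real r * x $ i))"
proof -
  have "cnj ((\<rho> *\<^sub>R x + r *\<^sub>R y) $ i) * x $ i
      = of_real (\<rho> * (cmod (x $ i))\<^sup>2) + cnj (y $ i) * (of_real r * x $ i)" for i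
  proof -
    have "cnj (x $ i) * x $ i = of_real ((cmod (x $ i))\<^sup>2)"
      by (metis complex_norm_square mult.commute of_real_power)
    then show ?thesis
      by (simp add: scaleR_conv_of_real[where 'a=complex] distrib_right mult.assoc)
  qed
  then show ?thesis
    by (simp only: herm_prod_def sum.distrib power2_norm_vec sum_distrib_left of_real_sum)
qed

text \<open>The division by the squared norm goes into \<open>t\<close>. The norm then cancels from
  the denominator \<open>1 + s * \<gamma> * (1 - \<rho>\<^sup>2)\<close> and survives only linearly
  in the exponent, so averaging over the estimate again needs just a transform of its squared
  norm.\<close>

lemma (in prob_space) snr_G2A_laplace_fixed:
  fixes x :: "complex ^ 'n"
  assumes z: "std_complex_normal_vec M z" and x: "x \<noteq> 0" and \<gamma>: "\<gamma> \<ge> 0" and s: "s \<ge> 0" and \<rho>: "\<rho>\<^sup>2 \<le> 1"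
  shows "(\<integral>\<^sup>+\<omega>. ennreal (exp (- s * snr_G2A \<gamma> \<rho> x (z \<omega>))) \<partial>M)
    = ennreal (1 / (1 + s * \<gamma> * (1 - \<rho>\<^sup>2)))
      * ennreal (exp (- (s * \<gamma> * \<rho>\<^sup>2 / (1 + s * \<gamma> * (1 - \<rho>\<^sup>2))) * (norm x)\<^sup>2))"
proof -
  define N where "N = (norm x)\<^sup>2"
  have N: "N > 0" using x by (simp add: N_def)
  define t where "t = s * \<gamma> / N"
  have t: "t \<ge> 0" using s \<gamma> N by (simp add: t_def)
  define u where "u i = of_real (sqrt (1 - \<rho>\<^sup>2)) * x $ i" for i
  have "(\<Sum>i\<in>UNIV. (cmod (u i))\<^sup>2) = (1 - \<rho>\<^sup>2) * N"
    using \<rho> unfolding N_def power2_norm_vec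
    by (simp add: u_def norm_mult power_mult_distrib sum_distrib_left)
  then have tu: "t * (\<Sum>i\<in>UNIV. (cmod (u i))\<^sup>2) = s * \<gamma> * (1 - \<rho>\<^sup>2)"
    using N by (simp add: t_def)
  have a: "t * (cmod (of_real (\<rho> * N)))\<^sup>2 = s * \<gamma> * \<rho>\<^sup>2 * N"
    using N unfolding norm_of_real power2_abs power_mult_distrib
    by (simp add: t_def power2_eq_square)
  have "- s * snr_G2A \<gamma> \<rho> x y = - t * (cmod (of_real (\<rho> * N) + (\<Sum>i\<in>UNIV. cnj (y $ i) * u i)))\<^sup>2" for y
    unfolding snr_G2A_def herm_prod_aged N_def[symmetric] u_def by (simp add: t_def)
  then have "(\<integral>\<^sup>+\<omega>. ennreal (exp (- s * snr_G2A \<gamma> \<rho> x (z \<omega>))) \<partial>M)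
    = ennreal (exp (- (t * (cmod (of_real (\<rho> * N)))\<^sup>2) / (1 + s * \<gamma> * (1 - \<rho>\<^sup>2))) / (1 + s * \<gamma> * (1 - \<rho>\<^sup>2)))"
    using std_complex_normal_vec_laplace[OF z t, of "of_real (\<rho> * N)" u] unfolding tu
    by (simp only: mult_minus_left)
  also have "\<dots> = ennreal (1 / (1 + s * \<gamma> * (1 - \<rho>\<^sup>2)) * exp (- (s * \<gamma> * \<rho>\<^sup>2 / (1 + s * \<gamma> * (1 - \<rho>\<^sup>2))) * N))"
    unfolding a by simp
  finally show ?thesis
    using s \<gamma> \<rho> by (simp only: N_def ennreal_mult'[symmetric] exp_ge_zero ennreal_mult'' )
qed

text \<open>The estimate is frozen first, the innovation averaged, and the remaining exponential in
  the squared norm is the Rician transform at \<open>v\<close>.\<close>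

lemma (in prob_space) snr_G2A_laplace:
  fixes h z :: "'a \<Rightarrow> complex ^ 'n"
  assumes h: "rician_vec M \<kappa> h" and \<kappa>: "\<kappa> > 0"
    and z: "std_complex_normal_vec M z" and ind: "indep_var borel h borel z"
    and \<gamma>: "\<gamma> \<ge> 0" and s: "s \<ge> 0" and \<rho>: "\<rho>\<^sup>2 \<le> 1"
  defines "D \<equiv> \<kappa> + 1 + s * \<gamma> * (\<kappa> * (1 - \<rho>\<^sup>2) + 1)"
  shows "(\<integral>\<^sup>+\<omega>. ennreal (exp (- s * snr_G2A \<gamma> \<rho> (h \<omega>) (z \<omega>))) \<partial>M)
    = ennreal (exp (- (real CARD('n) * \<kappa> * s * \<gamma> * \<rho>\<^sup>2 / D))
        * (1 + s * \<gamma> * (1 - \<rho>\<^sup>2)) ^ (CARD('n) - 1) * ((\<kappa> + 1) / D) ^ CARD('n))"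
proof -
  define d where "d = 1 + s * \<gamma> * (1 - \<rho>\<^sup>2)"
  define v where "v = s * \<gamma> * \<rho>\<^sup>2 / d"
  have d: "d > 0" using s \<gamma> \<rho> by (simp add: d_def add_pos_nonneg)
  have v: "v \<ge> 0" using s \<gamma> d by (simp add: v_def)
  \<comment> \<open>Over the common denominator \<open>d\<close> the coefficient of
    \<open>s * \<gamma>\<close> is
    \<open>(\<kappa> + 1) * (1 - \<rho>\<^sup>2) + \<rho>\<^sup>2\<close>, which equals
    \<open>\<kappa> * (1 - \<rho>\<^sup>2) + 1\<close>.\<close>
  have Dd: "\<kappa> + 1 + v = D / d"
    using d by (simp add: v_def D_def field_simps) (simp add: d_def algebra_simps)
  have D: "D > 0"
    using Dd d v \<kappa> by (metis add_pos_nonneg less_numeral_extra(1) zero_less_divide_iff add_pos_pos order_less_asym)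
  note [measurable] = borel_measurable_snr_G2A
  have hm [measurable]: "h \<in> borel_measurable M"
    using ind by (simp add: indep_var_distribution_eq)
  have "(\<integral>\<^sup>+\<omega>. ennreal (exp (- s * snr_G2A \<gamma> \<rho> (h \<omega>) (z \<omega>))) \<partial>M)
    = (\<integral>\<^sup>+\<omega>. (\<integral>\<^sup>+\<omega>'. ennreal (exp (- s * snr_G2A \<gamma> \<rho> (h \<omega>) (z \<omega>'))) \<partial>M) \<partial>M)"
    using nn_integral_indep_var[OF ind, of "\<lambda>p. ennreal (exp (- s * (case p of (x, y) \<Rightarrow> snr_G2A \<gamma> \<rho> x y)))"]
    by simp
  also have "\<dots> = (\<integral>\<^sup>+\<omega>. ennreal (1 / d) * ennreal (exp (- v * (norm (h \<omega>))\<^sup>2)) \<partial>M)"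
    unfolding v_def d_def
    by (rule nn_integral_cong_AE, rule AE_mp[OF rician_vec_nonzero[OF h \<kappa>] AE_I2], rule impI)
       (rule snr_G2A_laplace_fixed[OF z _ \<gamma> s \<rho>])
  also have "\<dots> = ennreal (1 / d) * (\<integral>\<^sup>+\<omega>. ennreal (exp (- v * (norm (h \<omega>))\<^sup>2)) \<partial>M)"
    by (rule nn_integral_cmult) measurable
  also have "\<dots> = ennreal (1 / d * (exp (- \<kappa> * v / (\<kappa> + 1 + v)) * ((\<kappa> + 1) / (\<kappa> + 1 + v))) ^ CARD('n))"
    unfolding rician_vec_laplace[OF h \<kappa> v] using d by (simp add: ennreal_mult'[symmetric])
  also have "1 / d * (exp (- \<kappa> * v / (\<kappa> + 1 + v)) * ((\<kappa> + 1) / (\<kappa> + 1 + v))) ^ CARD('n)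
      = exp (- (real CARD('n) * \<kappa> * s * \<gamma> * \<rho>\<^sup>2 / D)) * d ^ (CARD('n) - 1) * ((\<kappa> + 1) / D) ^ CARD('n)"
  proof -
    have "- \<kappa> * v / (\<kappa> + 1 + v) = - (\<kappa> * s * \<gamma> * \<rho>\<^sup>2 / D)"
      unfolding Dd using d by (simp add: v_def)
    then have "exp (- \<kappa> * v / (\<kappa> + 1 + v)) ^ CARD('n) = exp (- (real CARD('n) * \<kappa> * s * \<gamma> * \<rho>\<^sup>2 / D))"
      by (simp add: exp_of_nat_mult[symmetric] mult.assoc)
    \<comment> \<open>The prefactor \<open>1 / d\<close> from the innovation removes one of the
      \<open>CARD('n)\<close> powers of \<open>d\<close>, which yields the exponent
      \<open>CARD('n) - 1\<close>.\<close>
    moreover have "1 / d * ((\<kappa> + 1) / (\<kappa> + 1 + v)) ^ CARD('n) = d ^ (CARD('n) - 1) * ((\<kappa> + 1) / D) ^ CARD('n)"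
    proof -
      have "d ^ CARD('n) = d * d ^ (CARD('n) - 1)"
        by (simp add: power_eq_if)
      then show ?thesis
        unfolding Dd using d by (simp add: power_mult_distrib power_divide)
    qed
    ultimately show ?thesis
      by (simp only: power_mult_distrib mult.assoc mult.left_commute[of "1 / d"])
  qed
  finally show ?thesis
    by (simp add: d_def)
qed

section \<open>Matching the transforms and identifying the law\<close>

text \<open>The left side is the density integrated term by term, the right side the transform of
  the SNR, with \<open>r\<close> for \<rho>^2 and \<open>r'\<close> for its complement. The
  exponential does not depend on \<open>m\<close>, and pairing the powers of \<open>c * p\<close>
  with those of \<open>r\<close> leaves a binomial expansion.\<close>

lemma G2A_density_laplace_eq:
  fixes c p r' r \<gamma> \<kappa> s :: real and M :: nat
  assumes M: "M \<ge> 1" and "\<gamma> > 0" "\<kappa> > 0" "s \<ge> 0" "r' \<ge> 0" "r' + r = 1"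
    and c: "c = \<kappa> * r' + 1" and D: "D = \<kappa> + 1 + s * \<gamma> * c"
    and \<Xi>: "\<Xi> = real M * \<kappa> * r * (\<kappa> + 1) / \<gamma>" and p: "p = s + (\<kappa> + 1) / (\<gamma> * c)"
  shows "exp (- real M * (\<kappa> * r / c)) * ((\<kappa> + 1) / c) ^ M * (1 / \<gamma> ^ M)
      * (\<Sum>m = 0..M - 1. real ((M - 1) choose m) * (\<gamma> * r') ^ m * r ^ (M - m - 1)
           * (exp (\<Xi> / (c\<^sup>2 * p)) / (c ^ (M - m - 1) * p ^ Suc (M - m - 1))))
    = exp (- (real M * \<kappa> * s * \<gamma> * r / D)) * (1 + s * \<gamma> * r') ^ (M - 1) * ((\<kappa> + 1) / D) ^ M"
proof -
  have c0: "c > 0" using assms by (simp add: c add_nonneg_pos)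
  have D0: "D > 0" using assms c0 by (simp add: D add_pos_nonneg)
  have pD: "p = D / (\<gamma> * c)"
    unfolding p D using c0 \<open>\<gamma> > 0\<close> by (simp add: field_simps)
  have "(\<Sum>m = 0..M - 1. real ((M - 1) choose m) * (\<gamma> * r') ^ m * r ^ (M - m - 1)
           * (exp (\<Xi> / (c\<^sup>2 * p)) / (c ^ (M - m - 1) * p ^ Suc (M - m - 1))))
      = exp (\<Xi> / (c\<^sup>2 * p)) / p * (\<Sum>m\<le>M - 1. real ((M - 1) choose m) * (\<gamma> * r') ^ m * (r / (c * p)) ^ (M - 1 - m))"
    unfolding sum_distrib_left atLeast0AtMost
    by (intro sum.cong refl) (simp add: power_divide power_mult_distrib diff_commute[of M] mult_ac)
  also have "\<dots> = exp (\<Xi> / (c\<^sup>2 * p)) / p * (\<gamma> * r' + r / (c * p)) ^ (M - 1)"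
    by (simp only: binomial_ring)
  also have "\<gamma> * r' + r / (c * p) = \<gamma> * c * (1 + s * \<gamma> * r') / D"
  proof -
    \<comment> \<open>Here \<open>r' + r = 1\<close> enters: the part free of \<open>s\<close> is
      \<open>r' * (\<kappa> + 1) + r = \<kappa> * r' + 1 = c\<close>.\<close>
    have "r' * D + r = c * (1 + s * \<gamma> * r')"
      using \<open>r' + r = 1\<close> by (simp add: D c algebra_simps)
    then have "\<gamma> * (r' * D + r) / D = \<gamma> * c * (1 + s * \<gamma> * r') / D"
      by simp
    moreover have "\<gamma> * r' + r / (c * p) = \<gamma> * (r' * D + r) / D"
      using c0 D0 \<open>\<gamma> > 0\<close> by (simp add: pD field_simps)
    ultimately show ?thesis by simp
  qed
  finally have sum: "(\<Sum>m = 0..M - 1. real ((M - 1) choose m) * (\<gamma> * r') ^ m * r ^ (M - m - 1)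
           * (exp (\<Xi> / (c\<^sup>2 * p)) / (c ^ (M - m - 1) * p ^ Suc (M - m - 1))))
      = exp (\<Xi> / (c\<^sup>2 * p)) / p * (\<gamma> * c * (1 + s * \<gamma> * r') / D) ^ (M - 1)" .
  \<comment> \<open>Over the common denominator \<open>c * D\<close> the numerators combine to a
    multiple of \<open>(\<kappa> + 1) - D = - s * \<gamma> * c\<close>, which cancels
    \<open>c\<close>.\<close>
  have ex: "- real M * (\<kappa> * r / c) + \<Xi> / (c\<^sup>2 * p) = - (real M * \<kappa> * s * \<gamma> * r / D)"
  proof -
    have "\<Xi> / (c\<^sup>2 * p) = real M * \<kappa> * r * (\<kappa> + 1) / (c * D)"
      using c0 D0 \<open>\<gamma> > 0\<close> by (simp add: \<Xi> pD field_simps power2_eq_square)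
    moreover have "- real M * (\<kappa> * r / c) = - real M * \<kappa> * r * D / (c * D)"
      using c0 D0 by simp
    ultimately have "- real M * (\<kappa> * r / c) + \<Xi> / (c\<^sup>2 * p) = real M * \<kappa> * r * ((\<kappa> + 1) - D) / (c * D)"
      by (simp only: add_divide_distrib[symmetric]) (simp add: algebra_simps)
    also have "\<dots> = - (real M * \<kappa> * s * \<gamma> * r / D)"
      using c0 D0 by (simp add: D divide_simps)
    finally show ?thesis .
  qed
  have pw: "a ^ M = a * a ^ (M - 1)" for a :: real
    using M by (simp add: power_eq_if)
  show ?thesis
    unfolding sum ex[symmetric] exp_add pw using c0 D0 \<open>\<gamma> > 0\<close> \<open>\<kappa> > 0\<close>
    by (simp add: pD power_divide power_mult_distrib)
qed

theorem theorem1: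
  fixes P :: "'a measure"
    and h z :: "'a \<Rightarrow> complex ^ 'n"
    and M :: nat
    and \<gamma> \<kappa> \<rho> \<rho>' \<Xi> :: real
  assumes "prob_space P"
    and "M = CARD('n)"
    and "\<gamma> > 0" and "\<kappa> > 0" and "\<rho> \<in> {-1..1}"
    and "\<rho>' = sqrt (1 - \<rho>\<^sup>2)"
    and "rician_vec P \<kappa> h"
    and "std_complex_normal_vec P z"
    and "prob_space.indep_var P borel h borel z"
    and "\<Xi> = real M * \<kappa> * \<rho>\<^sup>2 * (\<kappa> + 1) / \<gamma>"
  shows "distributed P lborel (\<lambda>\<omega>. snr_G2A \<gamma> \<rho> (h \<omega>) (z \<omega>))
    (\<lambda>x. if x > 0 then ennreal (
        exp (- real M * (\<kappa> * \<rho>\<^sup>2 / (\<kappa> * \<rho>'\<^sup>2 + 1)) - (\<kappa> + 1) * x / (\<gamma> * (\<kappa> * \<rho>'\<^sup>2 + 1)))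
        * ((\<kappa> + 1) / (\<kappa> * \<rho>'\<^sup>2 + 1)) ^ M * (1 / \<gamma> ^ M)
        * (\<Sum>m = 0..M - 1. real ((M - 1) choose m) * (\<gamma> * \<rho>'\<^sup>2) ^ m * (\<rho>\<^sup>2) ^ (M - m - 1)
             * bessel_factor (M - m - 1) (\<kappa> * \<rho>'\<^sup>2 + 1) \<Xi> x))
      else 0)"
  (is "distributed P lborel ?X ?f")
proof -
  interpret prob_space P by fact
  have \<rho>1: "\<rho>\<^sup>2 \<le> 1"
    using \<open>\<rho> \<in> {-1..1}\<close> by (auto simp: abs_square_le_1)
  have \<rho>': "\<rho>'\<^sup>2 = 1 - \<rho>\<^sup>2"
    using \<rho>1 \<open>\<rho>' = _\<close> by simp
  define c where "c = \<kappa> * \<rho>'\<^sup>2 + 1"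
  have c: "c > 0" using \<open>\<kappa> > 0\<close> by (simp add: c_def add_nonneg_pos)
  have \<Xi>: "\<Xi> \<ge> 0" using assms(3,4,10) by simp
  have M1: "M \<ge> 1" using \<open>M = _\<close> by (simp add: Suc_leI)
  \<comment> \<open>This is the exponential rate of the claimed density; the Laplace weight shifts
    it to \<open>p = s + q\<close>.\<close>
  define q where "q = (\<kappa> + 1) / (\<gamma> * c)"
  have q: "q > 0" using c assms(3,4) by (simp add: q_def)
  define K where "K = exp (- real M * (\<kappa> * \<rho>\<^sup>2 / c)) * ((\<kappa> + 1) / c) ^ M * (1 / \<gamma> ^ M)"
  have K: "K \<ge> 0" using c assms(3,4) by (simp add: K_def)
  define w where "w m = real ((M - 1) choose m) * (\<gamma> * \<rho>'\<^sup>2) ^ m * (\<rho>\<^sup>2) ^ (M - m - 1)" for m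
  have w: "w m \<ge> 0" for m using assms(3) by (simp add: w_def)
  define B where "B m x = (x / c) ^ (M - m - 1) * bessel_clifford (M - m - 1) (x * \<Xi> / c\<^sup>2)" for m x
  have B: "B m x \<ge> 0" if "x > 0" for m x
    using that c \<Xi> by (simp add: B_def bessel_clifford_nonneg)
  have [measurable]: "B m \<in> borel_measurable borel" for m
    unfolding B_def by measurable
  \<comment> \<open>The claimed density with Bessel-Clifford terms, the factor
    \<open>exp (- q * x)\<close> moved inside the sum so that each summand can be integrated on its
    own.\<close>
  define g where "g x = ennreal (K * (\<Sum>m = 0..M - 1. w m * (exp (- q * x) * B m x))) * indicator {0<..} x" for x
  have f: "?f = g"
  proof (rule ext, goal_cases)
    case (1 x)
    show ?case
    proof (cases "x > 0")
    case True
    have "exp (- real M * (\<kappa> * \<rho>\<^sup>2 / c) - (\<kappa> + 1) * x / (\<gamma> * c))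
        = exp (- real M * (\<kappa> * \<rho>\<^sup>2 / c)) * exp (- q * x)"
      by (simp add: exp_add[symmetric] q_def)
    then show ?thesis
      using True bessel_factor_eq_bessel_clifford[OF c \<Xi> True]
      by (simp add: c_def[symmetric] K_def w_def B_def g_def sum_distrib_left mult_ac)
    qed (simp add: g_def)
  qed
  have fm [measurable]: "g \<in> borel_measurable borel"
    unfolding g_def by measurable
  have f_laplace: "(\<integral>\<^sup>+x. ennreal (exp (- s * x)) \<partial>density lborel g)
      = (\<integral>\<^sup>+\<omega>. ennreal (exp (- s * ?X \<omega>)) \<partial>P)" if s: "s \<ge> 0" for s
  proof -
    define p where "p = s + q"
    have p: "p > 0" using s q by (simp add: p_def)
    have "(\<integral>\<^sup>+x. ennreal (exp (- s * x)) \<partial>density lborel g) = (\<integral>\<^sup>+x. g x * ennreal (exp (- s * x)) \<partial>lborel)"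
      by (rule nn_integral_density) measurable
    also have "\<dots> = (\<integral>\<^sup>+x. ennreal K * (\<Sum>m = 0..M - 1. ennreal (w m) * (ennreal (exp (- p * x) * B m x) * indicator {0<..} x)) \<partial>lborel)"
    proof (rule nn_integral_cong)
      fix x
      show "g x * ennreal (exp (- s * x))
          = ennreal K * (\<Sum>m = 0..M - 1. ennreal (w m) * (ennreal (exp (- p * x) * B m x) * indicator {0<..} x))"
      proof (cases "x > 0")
        case True
        have e: "exp (- p * x) = exp (- s * x) * exp (- q * x)"
          by (simp add: p_def exp_add[symmetric] algebra_simps)
        have "g x * ennreal (exp (- s * x)) = ennreal (K * (\<Sum>m = 0..M - 1. w m * (exp (- q * x) * B m x)) * exp (- s * x))"
          unfolding g_def using True by (simp add: ennreal_mult'')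
        also have "K * (\<Sum>m = 0..M - 1. w m * (exp (- q * x) * B m x)) * exp (- s * x)
            = K * (\<Sum>m = 0..M - 1. w m * (exp (- p * x) * B m x))"
          unfolding e sum_distrib_left sum_distrib_right by (intro sum.cong refl) (simp only: mult_ac)
        finally show ?thesis
          using True K w B by (simp add: ennreal_mult'[symmetric] sum_ennreal)
      next
        case False
        then show ?thesis by (simp add: g_def)
      qed
    qed
    also have "\<dots> = ennreal K * (\<Sum>m = 0..M - 1. ennreal (w m)
        * (\<integral>\<^sup>+x. ennreal (exp (- p * x) * B m x) * indicator {0<..} x \<partial>lborel))"
      by (simp add: nn_integral_cmult nn_integral_sum)
    also have "\<dots> = ennreal K * (\<Sum>m = 0..M - 1. ennreal (w m)
        * ennreal (exp (\<Xi> / (c\<^sup>2 * p)) / (c ^ (M - m - 1) * p ^ Suc (M - m - 1))))"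
      unfolding B_def nn_integral_exp_bessel_clifford[OF p c \<Xi>] ..
    also have "\<dots> = ennreal (K * (\<Sum>m = 0..M - 1. w m
        * (exp (\<Xi> / (c\<^sup>2 * p)) / (c ^ (M - m - 1) * p ^ Suc (M - m - 1)))))"
      using K w p c by (simp add: ennreal_mult'[symmetric] sum_ennreal del: power_Suc)
    also have "K * (\<Sum>m = 0..M - 1. w m * (exp (\<Xi> / (c\<^sup>2 * p)) / (c ^ (M - m - 1) * p ^ Suc (M - m - 1))))
      = exp (- (real M * \<kappa> * s * \<gamma> * \<rho>\<^sup>2 / (\<kappa> + 1 + s * \<gamma> * c))) * (1 + s * \<gamma> * \<rho>'\<^sup>2) ^ (M - 1)
        * ((\<kappa> + 1) / (\<kappa> + 1 + s * \<gamma> * c)) ^ M"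
      unfolding K_def w_def
      by (rule G2A_density_laplace_eq) (use assms(3,4,10) s M1 \<rho>1 \<rho>' in \<open>auto simp: c_def p_def q_def\<close>)
    also have "ennreal \<dots> = (\<integral>\<^sup>+\<omega>. ennreal (exp (- s * ?X \<omega>)) \<partial>P)"
      unfolding c_def \<rho>' \<open>M = _\<close>
      by (rule snr_G2A_laplace[symmetric]) (use assms \<rho>1 s in auto)
    finally show ?thesis .
  qed
  have "h \<in> borel_measurable P" "z \<in> borel_measurable P"
    using assms(9) by (auto simp: indep_var_distribution_eq)
  then have X [measurable]: "?X \<in> borel_measurable P"
    using measurable_compose[OF measurable_Pair borel_measurable_snr_G2A, of h P z \<gamma> \<rho>] by simp
  \<comment> \<open>At \<open>s = 0\<close> the transform is the total mass, so normalisation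
    follows from the identity of transforms.\<close>
  have "prob_space (density lborel g)"
    using f_laplace[of 0] by (intro prob_spaceI) (simp add: emeasure_space_1)
  then have rf: "real_distribution (density lborel g)"
    by (simp add: real_distribution_def real_distribution_axioms_def)
  have "distr P borel ?X = density lborel g"
  proof (rule laplace_uniqueness)
    show "real_distribution (distr P borel ?X)"
      by (rule real_distribution_distr) simp
    show "AE x in distr P borel ?X. 0 \<le> x"
      using assms(3) by (simp add: AE_distr_iff snr_G2A_nonneg)
    show "AE x in density lborel g. 0 \<le> x"
      by (subst AE_density) (auto simp: g_def split: split_indicator)
    show "(\<integral>\<^sup>+x. ennreal (exp (- real n * x)) \<partial>distr P borel ?X)
        = (\<integral>\<^sup>+x. ennreal (exp (- real n * x)) \<partial>density lborel g)" for n
      using f_laplace[of "real n"] by (subst nn_integral_distr) auto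
  qed (rule rf)
  \<comment> \<open>Laws compared by characteristic functions live on \<open>borel\<close>, whereas
    \<open>distributed\<close> refers to \<open>lborel\<close>; the two have the same measurable
    sets.\<close>
  moreover have "distr P lborel ?X = distr P borel ?X"
    by (rule distr_cong) auto
  ultimately show ?thesis
    unfolding f distributed_def using X fm by simp
qed

end
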